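(* Let $X$ be a $p\times n$ random matrix from the multivariate scale family with unknown $\boldsymbol\theta=(\theta_1,\dots,\theta_p)$, $\theta_i>0$, let $r\in\mathbb{R}\setminus\{0\}$ be given, and let $\boldsymbol T(X)=(T_1(X),\dots,T_p(X))$ be an equivariant estimator of $\boldsymbol\theta^{(r)}=(\theta_1^r,\dots,\theta_p^r)$ with $T_i(X)>0$ almost everywhere for each $i$. Suppose the loss $L(\boldsymbol d,\boldsymbol\theta)=\sum_{i=1}^p h(d_i/\theta_i^r)$ is strictly convex, where $h$ is strictly convex with $h(1)=0$. Then, within the class of estimators of the form $\boldsymbol\delta(X)=w(Z)\,\boldsymbol T(X)$, with $w$ a scalar-valued function of the maximal invariant $Z$, a Pitman closest equivariant estimator of $\boldsymbol\theta^{(r)}$ is $$\boldsymbol\delta_\pi(X)=m(Z)\,\boldsymbol T(X),$$ where $m(Z)$ is a median of the conditional distribution, given $Z$ and under $\boldsymbol\theta=\mathbf 1=(1,\dots,1)$, of the univariate random variable $c^*$ defined by $$\boldsymbol T(X)^{\top}\,\nabla\tilde L\big(\mathbf 1-c^*\boldsymbol T(X)\big)=0,\qquad \tilde L(\boldsymbol e)=\sum_{i=1}^p h(1-e_i)\quad(\boldsymbol e\in\mathbb{R}^p),$$ so that $L(\boldsymbol d,\mathbf 1)=\tilde L(\mathbf 1-\boldsymbol d)$.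
   Context: Multivariate scale family: $X=(\boldsymbol X_1,\dots,\boldsymbol X_n)=(x_{i,j})$ is a $p\times n$ random matrix with joint density $f_P(\boldsymbol x_1,\dots,\boldsymbol x_n)=|P|^{-n}f(P^{-1}\boldsymbol x_1,\dots,P^{-1}\boldsymbol x_n)$, $\boldsymbol x_j\in\mathbb{R}^p$, where $f$ is a given density, $P=\mathrm{diag}(\theta_1,\dots,\theta_p)$ with $\theta_i>0$ is an unknown diagonal scale matrix, and $|P|$ is its determinant. Equivariance: an estimator $T(X)$ (with values in $\mathbb{R}^p$) of $\boldsymbol\theta^{(r)}$ is equivariant if $T(CX)=C^rT(X)$ for all $C=\mathrm{diag}(c_1,\dots,c_p)$ with $c_i>0$. Maximal invariant: $Z=(z_{i,j})$ is the $p\times n$ matrix with $z_{i,j}=x_{i,j}/x_{i,1}$ for $j\ne 1$ and $z_{i,1}=x_{i,1}/|x_{i,1}|$. Pitman closeness: for estimators $T_1,T_2$, $\mathrm{PC}(T_1,T_2;\boldsymbol\theta)=P_{\boldsymbol\theta}[L(T_1(X),\boldsymbol\theta)<L(T_2(X),\boldsymbol\theta)]$. An estimator $T_1$ in a class is a Pitman closest estimator in the class if $\mathrm{PC}(T_1,T_2;\boldsymbol\theta)\ge\mathrm{PC}(T_2,T_1;\boldsymbol\theta)$ for all $\boldsymbol\theta$ and every $T_2$ in the class. Here $h$ is a real-valued function on $\mathbb{R}$. Median: a number $m$ is a median of a univariate random variable $W$ if $P(W<m)\le 1/2$ and $P(W\le m)\ge 1/2$ (similarly for conditional distributions). *)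

theory Defs
  imports "HOL-Probability.Probability"
begin

text \<open>A \<open>p \<times> n\<close> data matrix is an element of \<^typ>\<open>real^'n^'p\<close>; entry \<open>(i, j)\<close> is \<open>X $ i $ j\<close> and
  the observation \<open>x\<^sub>j\<close> in \<open>\<real>\<^sup>p\<close> is the column \<^term>\<open>column j X\<close>.\<close>

definition diag_matrix :: "real^'p \<Rightarrow> real^'p^'p" where
  "diag_matrix c = (\<chi> i j. if i = j then c $ i else 0)"

definition vec_powr :: "real^'p \<Rightarrow> real \<Rightarrow> real^'p" where
  "vec_powr c r = (\<chi> i. c $ i powr r)"

definition positive_vectors :: "(real^'p) set" where
  "positive_vectors = {c. \<forall>i. c $ i > 0}"

text \<open>The columns of \<open>P\<^sup>-\<^sup>1 ** X\<close> are \<open>P\<^sup>-\<^sup>1 x\<^sub>1, \<dots>, P\<^sup>-\<^sup>1 x\<^sub>n\<close>.\<close>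

definition scale_density :: "(real^'n^'p \<Rightarrow> real) \<Rightarrow> real^'p \<Rightarrow> real^'n^'p \<Rightarrow> real" where
  "scale_density f \<theta> X =
     f (matrix_inv (diag_matrix \<theta>) ** X) / det (diag_matrix \<theta>) ^ CARD('n)"

text \<open>The sampling distribution of the data matrix, so that the identity plays the role of the
  random matrix and an estimator is a Borel function on matrices.\<close>

definition scale_family :: "(real^'n^'p \<Rightarrow> real) \<Rightarrow> real^'p \<Rightarrow> (real^'n^'p) measure" where
  "scale_family f \<theta> = density lborel (\<lambda>X. ennreal (scale_density f \<theta> X))"

definition probability_density :: "(real^'n^'p \<Rightarrow> real) \<Rightarrow> bool" where
  "probability_density f \<longleftrightarrow>
     f \<in> borel_measurable borel \<and> (\<forall>X. f X \<ge> 0) \<and> (\<integral>\<^sup>+X. ennreal (f X) \<partial>lborel) = 1"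

definition equivariant_estimator :: "real \<Rightarrow> (real^'n^'p \<Rightarrow> real^'p) \<Rightarrow> bool" where
  "equivariant_estimator r T \<longleftrightarrow>
     T \<in> borel_measurable borel \<and>
     (\<forall>c\<in>positive_vectors. \<forall>X. T (diag_matrix c ** X) = diag_matrix (vec_powr c r) *v T X)"

text \<open>The index \<open>k\<close> is the reference column (the first column in the usual presentation). Entries
  of the reference column that vanish are mapped to \<open>0\<close> by the convention for division; this
  only concerns a Lebesgue null set.\<close>

definition max_invariant :: "'n \<Rightarrow> real^'n^'p \<Rightarrow> real^'n^'p" where
  "max_invariant k X =
     (\<chi> i j. if j = k then X $ i $ k / \<bar>X $ i $ k\<bar> else X $ i $ j / X $ i $ k)"

definition strictly_convex_on :: "'a::real_vector set \<Rightarrow> ('a \<Rightarrow> real) \<Rightarrow> bool" where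
  "strictly_convex_on S g \<longleftrightarrow>
     convex S \<and>
     (\<forall>x\<in>S. \<forall>y\<in>S. \<forall>t. x \<noteq> y \<longrightarrow> 0 < t \<longrightarrow> t < 1 \<longrightarrow>
        g ((1 - t) *\<^sub>R x + t *\<^sub>R y) < (1 - t) * g x + t * g y)"

definition loss :: "(real \<Rightarrow> real) \<Rightarrow> real \<Rightarrow> real^'p \<Rightarrow> real^'p \<Rightarrow> real" where
  "loss h r d \<theta> = (\<Sum>i\<in>UNIV. h (d $ i / \<theta> $ i powr r))"

definition loss_tilde :: "(real \<Rightarrow> real) \<Rightarrow> real^'p \<Rightarrow> real" where
  "loss_tilde h e = (\<Sum>i\<in>UNIV. h (1 - e $ i))"

text \<open>The equation \<open>t\<^sup>T \<nabla>L\<^sup>~(1 - c t) = 0\<close>, which includes the existence of the gradient at the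
  point in question.\<close>

definition optimal_multiplier :: "(real \<Rightarrow> real) \<Rightarrow> real^'p \<Rightarrow> real \<Rightarrow> bool" where
  "optimal_multiplier h t c \<longleftrightarrow>
     (\<exists>G. GDERIV (loss_tilde h) (1 - c *\<^sub>R t) :> G \<and> t \<bullet> G = 0)"

definition pitman_closeness ::
  "('t \<Rightarrow> 'x measure) \<Rightarrow> ('d \<Rightarrow> 't \<Rightarrow> real) \<Rightarrow> ('x \<Rightarrow> 'd) \<Rightarrow> ('x \<Rightarrow> 'd) \<Rightarrow> 't \<Rightarrow> real" where
  "pitman_closeness P L T1 T2 \<theta> =
     measure (P \<theta>) {x \<in> space (P \<theta>). L (T1 x) \<theta> < L (T2 x) \<theta>}"

definition pitman_closest_in ::
  "('x \<Rightarrow> 'd) set \<Rightarrow> ('t \<Rightarrow> 'x measure) \<Rightarrow> 't set \<Rightarrow> ('d \<Rightarrow> 't \<Rightarrow> real) \<Rightarrow> ('x \<Rightarrow> 'd) \<Rightarrow> bool" where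
  "pitman_closest_in \<C> P \<Theta> L T1 \<longleftrightarrow>
     T1 \<in> \<C> \<and>
     (\<forall>\<theta>\<in>\<Theta>. \<forall>T2\<in>\<C>. pitman_closeness P L T1 T2 \<theta> \<ge> pitman_closeness P L T2 T1 \<theta>)"

definition invariant_multiples ::
  "'n \<Rightarrow> (real^'n^'p \<Rightarrow> real^'p) \<Rightarrow> (real^'n^'p \<Rightarrow> real^'p) set" where
  "invariant_multiples k T =
     {\<lambda>X. w (max_invariant k X) *\<^sub>R T X | w. w \<in> borel_measurable borel}"

text \<open>\<open>m\<close> is a median of a real random variable with distribution \<open>\<mu>\<close>.\<close>

definition is_median :: "real measure \<Rightarrow> real \<Rightarrow> bool" where
  "is_median \<mu> m \<longleftrightarrow> measure \<mu> {..<m} \<le> 1/2 \<and> measure \<mu> {..m} \<ge> 1/2"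

text \<open>\<open>\<kappa>\<close> is a regular version of the conditional distribution of \<open>W\<close> given \<open>Z\<close> under \<open>M\<close>: a
  probability kernel such that \<open>\<kappa>(Z)(B)\<close> is a version of \<open>P(W \<in> B | \<sigma>(Z))\<close> for every Borel
  set \<open>B\<close>.\<close>

definition conditional_distribution ::
  "'a measure \<Rightarrow> 'b measure \<Rightarrow> ('a \<Rightarrow> 'b) \<Rightarrow> ('a \<Rightarrow> real) \<Rightarrow> ('b \<Rightarrow> real measure) \<Rightarrow> bool" where
  "conditional_distribution M N Z W \<kappa> \<longleftrightarrow>
     Z \<in> measurable M N \<and> W \<in> borel_measurable M \<and>
     \<kappa> \<in> measurable N (prob_algebra borel) \<and>
     (\<forall>B\<in>sets borel. AE x in M.
        real_cond_exp M (vimage_algebra (space M) Z N) (indicator (W -` B \<inter> space M)) x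
          = measure (\<kappa> (Z x)) B)"

end

theory Submission
  imports Defs
begin

text \<open>
  Write \<open>\<delta>\<^sub>w = w(Z) T(X)\<close>. Scaling the rows of the data by \<open>\<theta>\<close> carries the distribution at \<open>\<one>\<close> to the one
  at \<open>\<theta>\<close>, leaves \<open>Z\<close> unchanged, and multiplies an equivariant estimate by exactly the factor that
  the loss divides out. Two equivariant estimators are therefore equally close under every \<open>\<theta>\<close>
  (\<open>pitman_closeness_equivariant\<close>), and only \<open>\<theta> = \<one>\<close> needs to be studied.

  At \<open>\<theta> = \<one>\<close>, the loss along the ray through \<open>T(X)\<close>, \<open>g(a) = L(a T(X), \<one>)\<close>, is a strictly convex
  function of one real variable. The equation defining \<open>c\<^sup>*\<close> says \<open>g'(c\<^sup>*) = 0\<close>, so \<open>c\<^sup>*\<close> minimises \<open>g\<close>,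
  and \<open>g\<close> grows strictly on either side of it (\<open>loss_less_towards_optimal_multiplier\<close>). Suppose
  \<open>w(Z) > m(Z)\<close>. If \<open>c\<^sup>* \<le> m(Z)\<close> then \<open>\<delta>\<^sub>m\<close> has the smaller loss, hence \<open>\<delta>\<^sub>w\<close> can win only if
  \<open>c\<^sup>* > m(Z)\<close>. Given \<open>Z\<close>, both \<open>w(Z)\<close> and \<open>m(Z)\<close> are constants, and since \<open>m(Z)\<close> is a conditional
  median the first event has conditional probability at least \<open>1/2\<close> and the second at most \<open>1/2\<close>.
  The case \<open>w(Z) < m(Z)\<close> is symmetric, and for \<open>w(Z) = m(Z)\<close> the losses agree.
  Integrating over \<open>Z\<close> gives the result (\<open>conditional_median_competitor_le\<close>).

  The last integration evaluates \<open>\<kappa>(Z)\<close> on half-lines that themselves depend on \<open>Z\<close>, while the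
  conditional distribution is specified one fixed Borel set at a time. The bridge is the
  disintegration of the joint law of \<open>Z\<close> and \<open>c\<^sup>*\<close>
  (\<open>conditional_distribution_disintegration\<close>).
\<close>

section \<open>Diagonal scaling of data matrices\<close>

lemma diag_matrix_mult_nth [simp]:
  fixes X :: "real^'n^'p"
  shows "(diag_matrix c ** X) $ i $ j = c $ i * X $ i $ j"
  by (simp add: matrix_matrix_mult_def diag_matrix_def if_distrib[where f = "\<lambda>u. u * _"] cong: if_cong)

lemma diag_matrix_vector_mult_nth [simp]: "(diag_matrix c *v x) $ i = c $ i * x $ i"
  by (simp add: matrix_vector_mult_def diag_matrix_def if_distrib[where f = "\<lambda>u. u * _"] cong: if_cong)

lemma det_diag_matrix: "det (diag_matrix c) = (\<Prod>i\<in>UNIV. c $ i)"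
  by (subst det_diagonal) (auto simp: diag_matrix_def)

lemma matrix_inv_diag_matrix:
  assumes "\<And>i. c $ i \<noteq> 0"
  shows "matrix_inv (diag_matrix c) = diag_matrix (\<chi> i. inverse (c $ i))" (is "_ = ?D")
proof -
  have right: "diag_matrix c ** ?D = mat 1" and left: "?D ** diag_matrix c = mat 1"
    using assms by (simp_all add: vec_eq_iff) (simp_all add: diag_matrix_def mat_def)
  then have "diag_matrix c ** matrix_inv (diag_matrix c) = mat 1"
    unfolding matrix_inv_def by (metis (mono_tags, lifting) someI)
  then have "?D ** (diag_matrix c ** matrix_inv (diag_matrix c)) = ?D"
    by simp
  then show ?thesis
    by (simp add: matrix_mul_assoc left)
qed

lemma measurable_diag_matrix_mult [measurable]:
  "(\<lambda>X :: real^'n^'p. diag_matrix c ** X) \<in> borel_measurable borel"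
  by (intro borel_measurable_continuous_onI)
     (auto simp: matrix_matrix_mult_def intro!: continuous_intros)

lemma Basis_matrix: "(Basis :: (real^'n^'p) set) = (\<lambda>(i, j). axis i (axis j 1)) ` UNIV"
  by (auto simp: Basis_vec_def image_iff)

lemma prod_Basis_matrix:
  "(\<Prod>b\<in>(Basis :: (real^'n^'p) set). g b) = (\<Prod>i\<in>UNIV. \<Prod>j\<in>UNIV. g (axis i (axis j 1)))"
proof -
  have inj: "inj (\<lambda>(i, j). axis i (axis j 1) :: real^'n^'p)"
    by (auto simp: inj_on_def axis_eq_axis)
  show ?thesis
    unfolding Basis_matrix
    by (subst prod.reindex[OF inj]) (simp add: prod.cartesian_product case_prod_unfold)
qed

text \<open>On matrices the map \<open>X \<mapsto> diag(c) X\<close> is diagonal in the standard basis, where the factor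
  \<open>c\<^sub>i\<close> occurs once for each of the \<open>n\<close> entries of row \<open>i\<close>; hence the Jacobian \<open>det(diag(c))\<^sup>n\<close>.\<close>

lemma lborel_eq_diag_scaled:
  fixes c :: "real^'p"
  assumes c: "c \<in> positive_vectors"
  shows "(lborel :: (real^'n^'p) measure) =
    density (distr lborel borel (\<lambda>X. diag_matrix c ** X))
      (\<lambda>_. ennreal (det (diag_matrix c) ^ CARD('n)))"
proof -
  \<comment> \<open>On a matrix unit with its one in row \<open>i\<close>, the factor \<open>s\<close> is \<open>c $ i\<close>.\<close>
  define s :: "real^'n^'p \<Rightarrow> real" where "s b = (\<Sum>i\<in>UNIV. c $ i * (\<Sum>j\<in>UNIV. b $ i $ j))" for b
  have s: "s (axis i (axis j 1)) = c $ i" for i j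
  proof -
    have "s (axis i (axis j 1)) = (\<Sum>l\<in>UNIV. if l = i then c $ i else 0)"
      unfolding s_def by (intro sum.cong refl) (auto simp: axis_def)
    then show ?thesis by simp
  qed
  have pos: "c $ i > 0" for i
    using c by (simp add: positive_vectors_def)
  have eq: "0 + (\<Sum>b\<in>Basis. (s b * (X \<bullet> b)) *\<^sub>R b) = diag_matrix c ** X" for X
  proof (rule euclidean_eqI)
    fix b :: "real^'n^'p" assume b: "b \<in> Basis"
    then obtain i j where [simp]: "b = axis i (axis j 1)"
      by (auto simp: Basis_matrix)
    have "(0 + (\<Sum>b\<in>Basis. (s b * (X \<bullet> b)) *\<^sub>R b)) \<bullet> b = s b * (X \<bullet> b)"
      using b by simp
    also have "\<dots> = (diag_matrix c ** X) \<bullet> b"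
      by (simp add: s inner_axis)
    finally show "(0 + (\<Sum>b\<in>Basis. (s b * (X \<bullet> b)) *\<^sub>R b)) \<bullet> b = (diag_matrix c ** X) \<bullet> b" .
  qed
  have "(\<Prod>b\<in>Basis. \<bar>s b\<bar>) = det (diag_matrix c) ^ CARD('n)"
    using pos by (simp add: prod_Basis_matrix s det_diag_matrix prod_power_distrib abs_of_pos)
  moreover have "b \<in> Basis \<Longrightarrow> s b \<noteq> 0" for b
    using pos by (auto simp: Basis_matrix s less_imp_neq[symmetric])
  ultimately show ?thesis
    using lborel_affine_euclidean[of s 0] unfolding eq by simp
qed

lemma scale_family_one:
  fixes f :: "real^'n^'p \<Rightarrow> real"
  shows "scale_family f 1 = density lborel (\<lambda>X. ennreal (f X))"
proof -
  have "diag_matrix (\<chi> i. 1) ** X = X" for X :: "real^'n^'p"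
    by (simp add: vec_eq_iff)
  then show ?thesis
    by (simp add: scale_family_def scale_density_def matrix_inv_diag_matrix det_diag_matrix)
qed

text \<open>The normalising factor in the density of the scale family is the inverse of this Jacobian, so the
  family consists of the laws of \<open>diag(\<theta>) X\<close> for \<open>X\<close> distributed with density \<open>f\<close>.\<close>

lemma scale_family_eq_distr:
  fixes f :: "real^'n^'p \<Rightarrow> real"
  assumes f: "probability_density f" and \<theta>: "\<theta> \<in> positive_vectors"
  shows "scale_family f \<theta> = distr (scale_family f 1) borel (\<lambda>X. diag_matrix \<theta> ** X)"
proof -
  let ?S = "\<lambda>X :: real^'n^'p. diag_matrix \<theta> ** X"
  let ?D = "diag_matrix (\<chi> i. inverse (\<theta> $ i))"
  let ?J = "det (diag_matrix \<theta>) ^ CARD('n)"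
  have [measurable]: "f \<in> borel_measurable borel"
    using f by (simp add: probability_density_def)
  have pos: "\<theta> $ i > 0" for i
    using \<theta> by (simp add: positive_vectors_def)
  then have J: "det (diag_matrix \<theta>) > 0"
    by (simp add: det_diag_matrix prod_pos)
  have inv: "matrix_inv (diag_matrix \<theta>) = ?D"
    using pos by (intro matrix_inv_diag_matrix) (simp add: less_imp_neq[symmetric])
  have DS: "?D ** ?S X = X" for X
    using pos by (simp add: vec_eq_iff less_imp_neq[symmetric])
  have dens: "ennreal ?J * ennreal (scale_density f \<theta> X) = ennreal (f (?D ** X))" for X
    using J by (simp add: scale_density_def inv ennreal_mult'[symmetric])
  have "scale_family f \<theta> =
      density (density (distr lborel borel ?S) (\<lambda>_. ennreal ?J)) (\<lambda>X. ennreal (scale_density f \<theta> X))"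
    unfolding scale_family_def by (subst lborel_eq_diag_scaled[OF \<theta>]) rule
  also have "\<dots> = density (distr lborel borel ?S) (\<lambda>X. ennreal (f (?D ** X)))"
    unfolding scale_density_def inv
    by (subst density_density_eq) (simp_all add: dens[unfolded scale_density_def inv])
  also have "\<dots> = distr (density lborel (\<lambda>X. ennreal (f X))) borel ?S"
    by (subst density_distr) (simp_all add: DS)
  finally show ?thesis
    by (simp add: scale_family_one)
qed

lemma sets_scale_family [measurable_cong, simp]: "sets (scale_family f \<theta>) = sets borel"
  by (simp add: scale_family_def)

lemma space_scale_family [simp]: "space (scale_family f \<theta>) = UNIV"
  by (simp add: scale_family_def)

lemma prob_space_scale_family_one:
  assumes "probability_density f"
  shows "prob_space (scale_family f 1)"
  using assms
  by (intro prob_spaceI) (simp add: scale_family_one emeasure_density probability_density_def)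

section \<open>Disintegration\<close>

text \<open>The defining property of conditional expectation, integrated over the event \<open>Z \<in> A\<close> of the
  conditioning \<open>\<sigma>\<close>-algebra.\<close>

lemma conditional_distribution_rectangle:
  assumes "prob_space M" and cd: "conditional_distribution M N Z W \<kappa>"
    and A: "A \<in> sets N" and B: "B \<in> sets borel"
  shows "emeasure M {x \<in> space M. Z x \<in> A \<and> W x \<in> B} =
    (\<integral>\<^sup>+x. indicator A (Z x) * emeasure (\<kappa> (Z x)) B \<partial>M)"
proof -
  interpret prob_space M by fact
  have [measurable]: "Z \<in> measurable M N" "W \<in> borel_measurable M" "A \<in> sets N" "B \<in> sets borel"
    and \<kappa>: "\<kappa> \<in> measurable N (prob_algebra borel)"
    using cd A B by (auto simp: conditional_distribution_def)
  note [measurable] = measurable_prob_algebraD[OF \<kappa>]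
  define F where "F = vimage_algebra (space M) Z N"
  define AZ where "AZ = Z -` A \<inter> space M"
  have ZS: "Z \<in> space M \<rightarrow> space N"
    using \<open>Z \<in> measurable M N\<close> by (simp add: measurable_def)
  have "subalgebra M F"
    using ZS by (auto simp: subalgebra_def F_def sets_vimage_algebra2)
  then interpret finite_measure_subalgebra M F
    by unfold_locales
  have AZ: "AZ \<in> sets F"
    using ZS A by (auto simp: F_def AZ_def sets_vimage_algebra2)
  have [measurable]: "AZ \<in> sets M" "W -` B \<inter> space M \<in> sets M"
    unfolding AZ_def by measurable
  have prob: "prob_space (\<kappa> (Z x))" "sets (\<kappa> (Z x)) = sets borel" if "x \<in> space M" for x
    using measurable_space[OF \<kappa>, of "Z x"] ZS that by (auto simp: space_prob_algebra)
  have eq: "emeasure (\<kappa> (Z x)) B = ennreal (measure (\<kappa> (Z x)) B)" if "x \<in> space M" for x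
    using prob[OF that] by (simp add: finite_measure.emeasure_eq_measure prob_space.finite_measure)
  have [measurable]: "(\<lambda>x. measure (\<kappa> (Z x)) B) \<in> borel_measurable M"
    by measurable
  have "measure M {x \<in> space M. Z x \<in> A \<and> W x \<in> B} = (\<integral>x\<in>AZ. indicator (W -` B \<inter> space M) x \<partial>M)"
    unfolding set_lebesgue_integral_def
    by (subst Bochner_Integration.integral_cong
         [where g = "indicator {x \<in> space M. Z x \<in> A \<and> W x \<in> B}", OF refl])
       (auto simp: AZ_def split: split_indicator)
  also have "\<dots> = (\<integral>x\<in>AZ. real_cond_exp M F (indicator (W -` B \<inter> space M)) x \<partial>M)"
    using AZ by (intro real_cond_exp_intA integrable_real_indicator) (auto simp: less_top[symmetric])
  also have "\<dots> = (\<integral>x\<in>AZ. measure (\<kappa> (Z x)) B \<partial>M)"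
    using cd B unfolding conditional_distribution_def F_def[symmetric] set_lebesgue_integral_def
    by (intro integral_cong_AE) auto
  finally have "ennreal (measure M {x \<in> space M. Z x \<in> A \<and> W x \<in> B}) =
      ennreal (\<integral>x. indicator AZ x * measure (\<kappa> (Z x)) B \<partial>M)"
    by (simp add: set_lebesgue_integral_def)
  also have "\<dots> = (\<integral>\<^sup>+x. ennreal (indicator AZ x * measure (\<kappa> (Z x)) B) \<partial>M)"
    using prob by (intro nn_integral_eq_integral[symmetric] integrable_const_bound[where B = 1])
      (auto intro!: AE_I2 prob_space.prob_le_1 split: split_indicator)
  also have "\<dots> = (\<integral>\<^sup>+x. indicator A (Z x) * emeasure (\<kappa> (Z x)) B \<partial>M)"
    by (intro nn_integral_cong) (auto simp: eq AZ_def split: split_indicator)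
  finally show ?thesis
    by (simp add: emeasure_eq_measure)
qed

text \<open>Both sides are probability measures in \<open>S\<close>: the joint law of \<open>(Z, W)\<close>, and the mixture of the
  kernels \<open>\<kappa>(Z)\<close> placed on the fibres over \<open>Z\<close>. They agree on rectangles, an intersection-stable
  generator, hence everywhere. This allows the event for \<open>W\<close> to depend on \<open>Z\<close>.\<close>

lemma conditional_distribution_disintegration:
  assumes "prob_space M" and cd: "conditional_distribution M N Z W \<kappa>"
    and S: "S \<in> sets (N \<Otimes>\<^sub>M borel)"
  shows "emeasure M {x \<in> space M. (Z x, W x) \<in> S} =
    (\<integral>\<^sup>+x. emeasure (\<kappa> (Z x)) {w. (Z x, w) \<in> S} \<partial>M)"
proof -
  interpret prob_space M by fact
  have [measurable]: "Z \<in> measurable M N" "W \<in> borel_measurable M"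
    and \<kappa>: "\<kappa> \<in> measurable N (prob_algebra borel)"
    using cd by (auto simp: conditional_distribution_def)
  note [measurable] = measurable_prob_algebraD[OF \<kappa>]
  have ZS: "Z x \<in> space N" if "x \<in> space M" for x
    using measurable_space[OF \<open>Z \<in> measurable M N\<close>] that by blast
  have prob: "prob_space (\<kappa> (Z x))" "sets (\<kappa> (Z x)) = sets borel" if "x \<in> space M" for x
    using measurable_space[OF \<kappa>, of "Z x"] ZS that by (auto simp: space_prob_algebra)
  \<comment> \<open>Writing the right-hand side as a monadic bind makes it a measure by construction, so the
    uniqueness theorem for measures applies.\<close>
  define K where "K x = distr (\<kappa> (Z x)) (N \<Otimes>\<^sub>M borel) (\<lambda>w. (Z x, w))" for x
  have K: "K \<in> measurable M (subprob_algebra (N \<Otimes>\<^sub>M borel))"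
    unfolding K_def by (rule measurable_distr2) measurable
  have emK: "emeasure (K x) C = emeasure (\<kappa> (Z x)) {w. (Z x, w) \<in> C}"
    if "x \<in> space M" "C \<in> sets (N \<Otimes>\<^sub>M borel)" for x C
  proof -
    note [measurable_cong] = prob(2)[OF that(1)]
    have "space (\<kappa> (Z x)) = UNIV"
      using prob(2)[OF that(1)] by (auto dest: sets_eq_imp_space_eq)
    moreover have "(\<lambda>w. (Z x, w)) \<in> measurable (\<kappa> (Z x)) (N \<Otimes>\<^sub>M borel)"
      unfolding measurable_cong_sets[OF prob(2)[OF that(1)] refl] using ZS[OF that(1)] by measurable
    ultimately show ?thesis
      using that(2) by (simp add: K_def emeasure_distr vimage_def)
  qed
  have bind: "emeasure (M \<bind> K) C = (\<integral>\<^sup>+x. emeasure (\<kappa> (Z x)) {w. (Z x, w) \<in> C} \<partial>M)"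
    if "C \<in> sets (N \<Otimes>\<^sub>M borel)" for C
    using that by (subst emeasure_bind[OF not_empty K]) (auto intro!: nn_integral_cong emK)
  have joint: "emeasure (distr M (N \<Otimes>\<^sub>M borel) (\<lambda>x. (Z x, W x))) C =
      emeasure M {x \<in> space M. (Z x, W x) \<in> C}" if "C \<in> sets (N \<Otimes>\<^sub>M borel)" for C
    using that by (subst emeasure_distr) (auto intro!: arg_cong[where f = "emeasure M"])
  have "distr M (N \<Otimes>\<^sub>M borel) (\<lambda>x. (Z x, W x)) = M \<bind> K"
  proof (rule measure_eqI_generator_eq[OF Int_stable_pair_measure_generator[of N borel],
        where A = "\<lambda>_. space N \<times> UNIV"])
    show "{a \<times> b |a b. a \<in> sets N \<and> b \<in> sets borel} \<subseteq> Pow (space N \<times> (UNIV :: real set))"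
      by (auto dest: sets.sets_into_space)
    fix C assume "C \<in> {a \<times> b |a b. a \<in> sets N \<and> b \<in> sets (borel :: real measure)}"
    then obtain a b where C: "C = a \<times> b" "a \<in> sets N" "b \<in> sets borel"
      by auto
    have "emeasure M {x \<in> space M. (Z x, W x) \<in> C} =
        (\<integral>\<^sup>+x. emeasure (\<kappa> (Z x)) {w. (Z x, w) \<in> C} \<partial>M)"
      unfolding C(1) mem_Times_iff fst_conv snd_conv
      by (subst conditional_distribution_rectangle[OF \<open>prob_space M\<close> cd C(2,3)])
         (auto intro!: nn_integral_cong split: split_indicator)
    then show "emeasure (distr M (N \<Otimes>\<^sub>M borel) (\<lambda>x. (Z x, W x))) C = emeasure (M \<bind> K) C"
      using C by (simp add: joint bind)
  next
    show "sets (distr M (N \<Otimes>\<^sub>M borel) (\<lambda>x. (Z x, W x))) =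
        sigma_sets (space N \<times> UNIV) {a \<times> b |a b. a \<in> sets N \<and> b \<in> sets (borel :: real measure)}"
      by (simp add: sets_pair_measure)
    show "sets (M \<bind> K) =
        sigma_sets (space N \<times> UNIV) {a \<times> b |a b. a \<in> sets N \<and> b \<in> sets (borel :: real measure)}"
      using K not_empty by (subst sets_bind[OF sets_kernel[OF K]]) (auto simp: sets_pair_measure)
  next
    show "range (\<lambda>_. space N \<times> UNIV) \<subseteq> {a \<times> b |a b. a \<in> sets N \<and> b \<in> sets (borel :: real measure)}"
      by (intro image_subsetI CollectI exI conjI) (rule refl, simp_all)
    have "space N \<times> UNIV \<in> sets (N \<Otimes>\<^sub>M (borel :: real measure))"
      by auto
    then show "emeasure (distr M (N \<Otimes>\<^sub>M borel) (\<lambda>x. (Z x, W x))) (space N \<times> UNIV) \<noteq> \<infinity>"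
      by (simp only: joint) (auto simp: emeasure_eq_measure)
  qed auto
  then show ?thesis
    using joint[OF S] bind[OF S] by simp
qed

section \<open>Loss along a ray\<close>

lemma strictly_convex_on_imp_convex_on:
  assumes "strictly_convex_on S g"
  shows "convex_on S g"
  using assms unfolding strictly_convex_on_def
  by (intro convex_onI; elim conjE) (metis (no_types, lifting) distrib_right diff_add_cancel less_imp_le mult_1 order_refl scaleR_collapse)+

text \<open>A point strictly between a minimiser \<open>c\<close> and \<open>b\<close> is a proper convex combination of the two, so its
  value is below the corresponding average, which is at most \<open>g(b)\<close>. Treating both sides of \<open>c\<close>
  together is possible because the combination is the same.\<close>

lemma strictly_convex_less_towards_minimum:
  fixes g :: "real \<Rightarrow> real"
  assumes g: "strictly_convex_on UNIV g" and min: "\<And>x. g c \<le> g x"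
    and between: "c \<le> a \<and> a < b \<or> b < a \<and> a \<le> c"
  shows "g a < g b"
proof -
  define s where "s = (a - c) / (b - c)"
  have "b \<noteq> c" and s: "0 \<le> s" "s < 1" and a: "a = (1 - s) * c + s * b"
    using between by (auto simp: s_def field_simps)
  have conv: "g ((1 - t) * c + t * b) < (1 - t) * g c + t * g b" if "0 < t" "t < 1" for t
    using g \<open>b \<noteq> c\<close> that unfolding strictly_convex_on_def by fastforce
  \<comment> \<open>The midpoint shows that the minimum is strict, which covers the case \<open>a = c\<close>.\<close>
  have "g c < g b"
    using conv[of "1/2"] min[of "(1 - 1/2) * c + 1/2 * b"] by simp
  show ?thesis
  proof (cases "s = 0")
    case True
    then show ?thesis using a \<open>g c < g b\<close> by simp
  next
    case False
    then have "g a < (1 - s) * g c + s * g b"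
      using conv[of s] s a by simp
    also have "\<dots> \<le> (1 - s) * g b + s * g b"
      using \<open>g c < g b\<close> s by (intro add_right_mono mult_left_mono) auto
    finally show ?thesis by (simp add: algebra_simps)
  qed
qed

text \<open>By the chain rule the derivative of \<open>a \<mapsto> L(a t, \<one>)\<close> at \<open>c\<close> is \<open>-t \<bullet> G\<close>, where \<open>G\<close> is the gradient in
  the defining equation of \<open>c\<close>; so \<open>c\<close> is a critical point of a convex function, that is, a
  minimiser. The restriction to the ray is strictly convex because \<open>t \<noteq> 0\<close> keeps distinct multiples
  of \<open>t\<close> distinct.\<close>

lemma loss_less_towards_optimal_multiplier:
  fixes t :: "real^'p"
  assumes conv: "strictly_convex_on UNIV (\<lambda>d :: real^'p. loss h r d 1)" and "t \<noteq> 0"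
    and opt: "optimal_multiplier h t c"
    and between: "c \<le> a \<and> a < b \<or> b < a \<and> a \<le> c"
  shows "loss h r (a *\<^sub>R t) 1 < loss h r (b *\<^sub>R t) 1"
proof -
  define g where "g a = loss h r (a *\<^sub>R t) 1" for a
  have g_tilde: "g = (\<lambda>a. loss_tilde h (1 - a *\<^sub>R t))"
    by (simp add: g_def loss_def loss_tilde_def fun_eq_iff)
  have g: "strictly_convex_on UNIV g"
    unfolding strictly_convex_on_def
  proof (intro conjI ballI allI impI)
    fix x y s :: real assume "x \<noteq> y" "0 < s" "s < 1"
    then have "loss h r ((1 - s) *\<^sub>R (x *\<^sub>R t) + s *\<^sub>R (y *\<^sub>R t)) 1 <
        (1 - s) * loss h r (x *\<^sub>R t) 1 + s * loss h r (y *\<^sub>R t) 1"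
      using conv \<open>t \<noteq> 0\<close> by (auto simp: strictly_convex_on_def simp del: scaleR_scaleR)
    then show "g ((1 - s) *\<^sub>R x + s *\<^sub>R y) < (1 - s) * g x + s * g y"
      by (simp add: g_def scaleR_left_distrib)
  qed simp
  obtain G where G: "GDERIV (loss_tilde h) (1 - c *\<^sub>R t) :> G" "t \<bullet> G = 0"
    using opt by (auto simp: optimal_multiplier_def)
  have "((\<lambda>a. 1 - a *\<^sub>R t) has_derivative (\<lambda>u. - (u *\<^sub>R t))) (at c)"
    by (auto intro!: derivative_eq_intros)
  then have "(g has_derivative (\<lambda>u. (- (u *\<^sub>R t)) \<bullet> G)) (at c)"
    unfolding g_tilde using G(1) unfolding gderiv_def by (rule has_derivative_compose)
  then have "(g has_real_derivative 0) (at c)"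
    using G(2) by (simp add: has_field_derivative_def lambda_zero)
  then have "g c \<le> g x" for x
    using convex_on_imp_above_tangent[OF strictly_convex_on_imp_convex_on[OF g], of c x 0] by simp
  from strictly_convex_less_towards_minimum[OF g this between] show ?thesis
    by (simp add: g_def)
qed

section \<open>Medians and Pitman closeness\<close>

lemma is_median_complement_le:
  assumes "prob_space \<mu>" and [measurable_cong, simp]: "sets \<mu> = sets borel" and m: "is_median \<mu> m"
  shows "emeasure \<mu> {m<..} \<le> emeasure \<mu> {..m}" and "emeasure \<mu> {..<m} \<le> emeasure \<mu> {m..}"
proof -
  interpret prob_space \<mu> by fact
  have sp: "space \<mu> = UNIV"
    using sets_eq_imp_space_eq[OF assms(2)] by simp
  have "measure \<mu> {m<..} = 1 - measure \<mu> {..m}" "measure \<mu> {m..} = 1 - measure \<mu> {..<m}"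
    using prob_compl[of "{..m}"] prob_compl[of "{..<m}"]
    by (simp_all add: sp Compl_eq_Diff_UNIV[symmetric])
  then show "emeasure \<mu> {m<..} \<le> emeasure \<mu> {..m}" "emeasure \<mu> {..<m} \<le> emeasure \<mu> {m..}"
    using m by (auto simp: is_median_def emeasure_eq_measure)
qed

text \<open>In the application \<open>W\<close> is the optimal multiplier. The event on the left contains every sample on
  which the competitor \<open>w\<close> is strictly better than \<open>m\<close>, and on the event on the right \<open>m\<close> is strictly
  better. Given \<open>Z\<close>, each comparison is between a half-line bounded by the median and its
  complement.\<close>

lemma conditional_median_competitor_le:
  assumes M: "prob_space M" and cd: "conditional_distribution M N Z W \<kappa>"
    and [measurable]: "m \<in> borel_measurable N" "w \<in> borel_measurable N"
    and med: "AE x in M. is_median (\<kappa> (Z x)) (m (Z x))"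
  shows "emeasure M {x \<in> space M. m (Z x) < w (Z x) \<and> m (Z x) < W x \<or>
                                  w (Z x) < m (Z x) \<and> W x < m (Z x)} \<le>
         emeasure M {x \<in> space M. m (Z x) < w (Z x) \<and> W x \<le> m (Z x) \<or>
                                  w (Z x) < m (Z x) \<and> m (Z x) \<le> W x}"
proof -
  define S where "S = {(z, y). z \<in> space N \<and> (m z < w z \<and> m z < y \<or> w z < m z \<and> y < m z)}"
  define S' where "S' = {(z, y). z \<in> space N \<and> (m z < w z \<and> y \<le> m z \<or> w z < m z \<and> m z \<le> y)}"
  have Z: "Z \<in> measurable M N" and \<kappa>: "\<kappa> \<in> measurable N (prob_algebra borel)"
    using cd by (auto simp: conditional_distribution_def)
  have ZS: "Z x \<in> space N" if "x \<in> space M" for x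
    using measurable_space[OF Z] that by blast
  have "{p \<in> space (N \<Otimes>\<^sub>M borel). m (fst p) < w (fst p) \<and> m (fst p) < snd p \<or>
      w (fst p) < m (fst p) \<and> snd p < m (fst p)} \<in> sets (N \<Otimes>\<^sub>M borel)"
    by measurable
  then have S: "S \<in> sets (N \<Otimes>\<^sub>M borel)"
    by (rule back_subst[of "\<lambda>S. S \<in> sets (N \<Otimes>\<^sub>M borel)"]) (auto simp: S_def space_pair_measure)
  have "{p \<in> space (N \<Otimes>\<^sub>M borel). m (fst p) < w (fst p) \<and> snd p \<le> m (fst p) \<or>
      w (fst p) < m (fst p) \<and> m (fst p) \<le> snd p} \<in> sets (N \<Otimes>\<^sub>M borel)"
    by measurable
  then have S': "S' \<in> sets (N \<Otimes>\<^sub>M borel)"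
    by (rule back_subst[of "\<lambda>S. S \<in> sets (N \<Otimes>\<^sub>M borel)"]) (auto simp: S'_def space_pair_measure)
  have "(\<integral>\<^sup>+x. emeasure (\<kappa> (Z x)) {y. (Z x, y) \<in> S} \<partial>M) \<le>
      (\<integral>\<^sup>+x. emeasure (\<kappa> (Z x)) {y. (Z x, y) \<in> S'} \<partial>M)"
  proof (rule nn_integral_mono_AE)
    show "AE x in M. emeasure (\<kappa> (Z x)) {y. (Z x, y) \<in> S} \<le> emeasure (\<kappa> (Z x)) {y. (Z x, y) \<in> S'}"
      using med AE_space
    proof eventually_elim
      case (elim x)
      have "prob_space (\<kappa> (Z x))" "sets (\<kappa> (Z x)) = sets borel"
        using measurable_space[OF \<kappa>, of "Z x"] ZS elim by (auto simp: space_prob_algebra)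
      note le = is_median_complement_le[OF this elim(1)]
      show ?case
        using le ZS[OF elim(2)]
        by (cases "m (Z x)" "w (Z x)" rule: linorder_cases)
           (simp_all add: S_def S'_def greaterThan_def lessThan_def atMost_def atLeast_def
             order.asym)
    qed
  qed
  also note conditional_distribution_disintegration[OF M cd S', symmetric]
  finally have "emeasure M {x \<in> space M. (Z x, W x) \<in> S} \<le> emeasure M {x \<in> space M. (Z x, W x) \<in> S'}"
    unfolding conditional_distribution_disintegration[OF M cd S] .
  then show ?thesis
    using ZS by (simp add: S_def S'_def cong: conj_cong)
qed

section \<open>Reduction to unit scale\<close>

lemma max_invariant_scale:
  fixes X :: "real^'n^'p"
  assumes "c \<in> positive_vectors"
  shows "max_invariant k (diag_matrix c ** X) = max_invariant k X"
proof -
  have "c $ i > 0" for i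
    using assms by (simp add: positive_vectors_def)
  then show ?thesis
    by (simp add: max_invariant_def vec_eq_iff abs_mult abs_of_pos less_imp_neq[symmetric])
qed

lemma loss_scale:
  fixes d :: "real^'p"
  assumes "\<theta> \<in> positive_vectors"
  shows "loss h r (diag_matrix (vec_powr \<theta> r) *v d) \<theta> = loss h r d 1"
proof -
  have "\<theta> $ i > 0" for i
    using assms by (simp add: positive_vectors_def)
  then show ?thesis
    by (simp add: loss_def vec_powr_def less_imp_neq[symmetric])
qed

lemma equivariant_estimator_invariant_multiple:
  fixes T :: "real^'n^'p \<Rightarrow> real^'p" and k :: 'n
  assumes T: "equivariant_estimator r T"
    and [measurable]: "w \<in> borel_measurable borel" "(max_invariant k :: real^'n^'p \<Rightarrow> real^'n^'p) \<in> borel_measurable borel"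
  shows "equivariant_estimator r (\<lambda>X. w (max_invariant k X) *\<^sub>R T X)"
proof -
  have [measurable]: "T \<in> borel_measurable borel"
    using T by (simp add: equivariant_estimator_def)
  have "(\<lambda>X. w (max_invariant k X) *\<^sub>R T X) \<in> borel_measurable borel"
    by measurable
  then show ?thesis
    using T
    by (auto simp: equivariant_estimator_def max_invariant_scale vec_eq_iff mult.left_commute)
qed

text \<open>Convex functions on the whole line are continuous, hence Borel.\<close>

lemma borel_measurable_loss:
  assumes h: "strictly_convex_on UNIV h" and [measurable]: "T \<in> borel_measurable M"
  shows "(\<lambda>x. loss h r (T x :: real^'p) \<theta>) \<in> borel_measurable M"
proof -
  have "continuous_on UNIV h"
    by (intro convex_on_continuous strictly_convex_on_imp_convex_on h) simp
  then have [measurable]: "h \<in> borel_measurable borel"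
    by (rule borel_measurable_continuous_onI)
  have [measurable]: "(\<lambda>x. T x $ i) \<in> borel_measurable M" for i
    by (intro measurable_compose[OF _ borel_measurable_continuous_onI[of "\<lambda>v. v $ i"]] continuous_intros) measurable
  show ?thesis
    unfolding loss_def by measurable
qed

lemma pitman_closeness_equivariant:
  fixes f :: "real^'n^'p \<Rightarrow> real"
  assumes f: "probability_density f" and \<theta>: "\<theta> \<in> positive_vectors" and h: "strictly_convex_on UNIV h"
    and T1: "equivariant_estimator r T1" and T2: "equivariant_estimator r T2"
  shows "pitman_closeness (scale_family f) (loss h r) T1 T2 \<theta> =
    pitman_closeness (scale_family f) (loss h r) T1 T2 1"
proof -
  have [measurable]: "T1 \<in> borel_measurable borel" "T2 \<in> borel_measurable borel"
    using T1 T2 by (auto simp: equivariant_estimator_def)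
  note [measurable] = borel_measurable_loss[OF h]
  have "T1 (diag_matrix \<theta> ** X) = diag_matrix (vec_powr \<theta> r) *v T1 X"
    "T2 (diag_matrix \<theta> ** X) = diag_matrix (vec_powr \<theta> r) *v T2 X" for X
    using T1 T2 \<theta> by (auto simp: equivariant_estimator_def)
  then show ?thesis
    unfolding pitman_closeness_def scale_family_eq_distr[OF f \<theta>]
    by (subst measure_distr) (auto simp: loss_scale[OF \<theta>])
qed

theorem theorem3p3:
  fixes f :: "real^'n^'p \<Rightarrow> real"
    and k :: 'n
    and r :: real
    and T :: "real^'n^'p \<Rightarrow> real^'p"
    and h :: "real \<Rightarrow> real"
    and cstar :: "real^'n^'p \<Rightarrow> real"
    and \<kappa> :: "real^'n^'p \<Rightarrow> real measure"
    and m :: "real^'n^'p \<Rightarrow> real"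
  assumes "probability_density f"
    and "r \<noteq> 0"
    and "equivariant_estimator r T"
    and "\<And>\<theta> i. \<theta> \<in> positive_vectors \<Longrightarrow> AE X in scale_family f \<theta>. T X $ i > 0"
    and "strictly_convex_on UNIV h"
    and "h 1 = 0"
    and "\<And>\<theta> :: real^'p. \<theta> \<in> positive_vectors \<Longrightarrow> strictly_convex_on UNIV (\<lambda>d. loss h r d \<theta>)"
    and "cstar \<in> borel_measurable borel"
    and "AE X in scale_family f 1. optimal_multiplier h (T X) (cstar X)"
    and "conditional_distribution (scale_family f 1) borel (max_invariant k) cstar \<kappa>"
    and "m \<in> borel_measurable borel"
    and "AE X in scale_family f 1. is_median (\<kappa> (max_invariant k X)) (m (max_invariant k X))"
  shows "equivariant_estimator r (\<lambda>X. m (max_invariant k X) *\<^sub>R T X) \<and>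
         pitman_closest_in (invariant_multiples k T) (scale_family f) positive_vectors (loss h r)
           (\<lambda>X. m (max_invariant k X) *\<^sub>R T X)"
proof -
  let ?M = "scale_family f 1" and ?Z = "max_invariant k :: real^'n^'p \<Rightarrow> real^'n^'p"
  let ?\<delta> = "\<lambda>w X. w (?Z X) *\<^sub>R T X"
  let ?PC = "pitman_closeness (scale_family f) (loss h r)"
  interpret prob_space ?M
    by (rule prob_space_scale_family_one) fact
  note [measurable] = \<open>m \<in> borel_measurable borel\<close> \<open>cstar \<in> borel_measurable borel\<close>
    borel_measurable_loss[OF \<open>strictly_convex_on UNIV h\<close>]
  have [measurable]: "?Z \<in> borel_measurable borel"
    using assms(10) by (simp add: conditional_distribution_def cong: measurable_cong_sets)
  have [measurable]: "T \<in> borel_measurable borel"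
    using assms(3) by (simp add: equivariant_estimator_def)
  have one: "(1 :: real^'p) \<in> positive_vectors"
    by (simp add: positive_vectors_def)
  have equiv: "equivariant_estimator r (?\<delta> w)" if "w \<in> borel_measurable borel" for w
    using that by (intro equivariant_estimator_invariant_multiple assms(3)) simp_all
  \<comment> \<open>The null set is chosen before \<open>a\<close> and \<open>b\<close>, since these will be the random values \<open>m(Z)\<close> and
    \<open>w(Z)\<close>. The index is arbitrary: any positive coordinate makes \<open>T X\<close> nonzero.\<close>
  have less: "AE X in ?M. \<forall>a b. cstar X \<le> a \<and> a < b \<or> b < a \<and> a \<le> cstar X \<longrightarrow>
      loss h r (a *\<^sub>R T X) 1 < loss h r (b *\<^sub>R T X) 1"
    using assms(9) assms(4)[OF one, of undefined]
  proof eventually_elim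
    case (elim X)
    then have "T X \<noteq> 0" by auto
    then show ?case
      using loss_less_towards_optimal_multiplier[OF assms(7)[OF one] _ elim(1)] by blast
  qed
  have unit: "?PC (?\<delta> w) (?\<delta> m) 1 \<le> ?PC (?\<delta> m) (?\<delta> w) 1" if [measurable]: "w \<in> borel_measurable borel" for w
  proof -
    have "emeasure ?M {X \<in> space ?M. loss h r (?\<delta> w X) 1 < loss h r (?\<delta> m X) 1} \<le>
        emeasure ?M {X \<in> space ?M. m (?Z X) < w (?Z X) \<and> m (?Z X) < cstar X \<or>
                                   w (?Z X) < m (?Z X) \<and> cstar X < m (?Z X)}"
    proof (rule emeasure_mono_AE)
      show "AE X in ?M. X \<in> {X \<in> space ?M. loss h r (?\<delta> w X) 1 < loss h r (?\<delta> m X) 1} \<longrightarrow>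
          X \<in> {X \<in> space ?M. m (?Z X) < w (?Z X) \<and> m (?Z X) < cstar X \<or>
                               w (?Z X) < m (?Z X) \<and> cstar X < m (?Z X)}"
        using less
      proof eventually_elim
        case (elim X)
        show ?case
          using elim[rule_format, of "m (?Z X)" "w (?Z X)"]
          by (cases "m (?Z X)" "w (?Z X)" rule: linorder_cases) (auto simp: not_le[symmetric])
      qed
    qed measurable
    also have "\<dots> \<le> emeasure ?M {X \<in> space ?M. m (?Z X) < w (?Z X) \<and> cstar X \<le> m (?Z X) \<or>
                                   w (?Z X) < m (?Z X) \<and> m (?Z X) \<le> cstar X}"
      by (rule conditional_median_competitor_le[OF prob_space_axioms assms(10) _ _ assms(12)]) measurable
    also have "\<dots> \<le> emeasure ?M {X \<in> space ?M. loss h r (?\<delta> m X) 1 < loss h r (?\<delta> w X) 1}"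
    proof (rule emeasure_mono_AE)
      show "AE X in ?M. X \<in> {X \<in> space ?M. m (?Z X) < w (?Z X) \<and> cstar X \<le> m (?Z X) \<or>
                                   w (?Z X) < m (?Z X) \<and> m (?Z X) \<le> cstar X} \<longrightarrow>
          X \<in> {X \<in> space ?M. loss h r (?\<delta> m X) 1 < loss h r (?\<delta> w X) 1}"
        using less by eventually_elim auto
    qed measurable
    finally show ?thesis
      by (simp add: pitman_closeness_def emeasure_eq_measure)
  qed
  have "?PC (?\<delta> w) (?\<delta> m) \<theta> \<le> ?PC (?\<delta> m) (?\<delta> w) \<theta>"
    if "\<theta> \<in> positive_vectors" "w \<in> borel_measurable borel" for \<theta> w
    using unit[OF that(2)] pitman_closeness_equivariant[OF assms(1) that(1) assms(5)]
      equiv[OF that(2)] equiv[OF assms(11)] by simp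
  then show ?thesis
    using equiv[OF assms(11)] assms(11)
    unfolding pitman_closest_in_def invariant_multiples_def by blast
qed

end
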